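(* Let $\mathbb{F}$ be a field and let $B$ be a Blaschke product with strong Property $\mathfrak{B}$. Then for every $\epsilon>0$ there exists $\eta\in(0,1)$ such that for every Blaschke product $\widetilde{B}$ with strong Property $\mathfrak{B}$, $\|\widetilde{B}-B\|_\infty<\eta$ implies $d_{int}(\mathbb{B},\widetilde{\mathbb{B}})<\epsilon$, where $\mathbb{B}$ and $\widetilde{\mathbb{B}}$ are the persistence modules induced by $B$ and $\widetilde{B}$.
   Context: $\mathbb{D}$ is the open unit disk. An inner function is a bounded analytic function on $\mathbb{D}$ with unimodular radial limits almost everywhere on $\partial\mathbb{D}$. A Blaschke product is an inner function $B(z)=\lambda z^m\prod_n\frac{|\alpha_n|}{\alpha_n}\frac{\alpha_n-z}{1-\overline{\alpha_n}z}$ with $|\lambda|=1$, $m\ge0$ an integer, $\{\alpha_n\}$ a finite or infinite sequence in $\mathbb{D}\setminus\{0\}$ with $\sum_n(1-|\alpha_n|)<\infty$. $\|f\|_\infty=\sup_{z\in\mathbb{D}}|f(z)|$. For an inner function $u$ and $\theta\in(0,1)$ put $\Omega_{u,\theta}=\{z\in\mathbb{D}:|u(z)|<\theta\}$. Let $\rho(z_1,z_2)=\left|\frac{z_1-z_2}{1-\overline{z_1}z_2}\right|$ and $\delta_{u,\eta}=\sup\{\rho(z_1,z_2): z_1,z_2 \text{ belong to the same connected component of }\Omega_{u,\eta}\}$ (supremum in $[0,1]$). Property $\mathfrak{B}$: for every $\theta\in(0,1)$ the closure of each component of $\Omega_{u,\theta}$ is contained in $\mathbb{D}$. Strong Property $\mathfrak{B}$: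 $u$ has Property $\mathfrak{B}$ and there is $\eta\in(0,1)$ with $\delta_{u,\eta}<1$. Persistence module (over $\mathbb{F}$): vector spaces $\{V_t\}_{t\in\mathbb{R}}$ with linear maps $\pi_{s,t}:V_s\to V_t$ ($s\le t$) satisfying $\pi_{s,r}=\pi_{t,r}\circ\pi_{s,t}$, $\pi_{t,t}=\mathrm{id}$, and $V_s=0$ for all sufficiently small $s$. Morphisms are families of linear maps commuting with the structure maps. The shift $\mathbb{V}[\Delta]$ has $(V[\Delta])_t=V_{t+\Delta}$, $(\pi[\Delta])_{s,t}=\pi_{s+\Delta,t+\Delta}$; for $\Delta>0$, $\Phi^{\Delta}_{\mathbb{V}}:\mathbb{V}\to\mathbb{V}[\Delta]$ is given by $\pi_{t,t+\Delta}$. $\mathbb{V},\mathbb{W}$ are $\Delta$-interleaved if there are morphisms $F:\mathbb{V}\to\mathbb{W}[\Delta]$, $G:\mathbb{W}\to\mathbb{V}[\Delta]$ with $G[\Delta]\circ F=\Phi^{2\Delta}_{\mathbb{V}}$ and $F[\Delta]\circ G=\Phi^{2\Delta}_{\mathbb{W}}$; $d_{int}(\mathbb{V},\mathbb{W})=\inf\{\Delta>0:\mathbb{V},\mathbb{W}\text{ are }\Delta\text{-interleaved}\}$. Persistence module induced by an inner function $u$: for $t>0$ let $\theta(t)=\frac{e^t-1}{e^t+1}$ and $\Sigma_{u,t}=\Omega_{u,\theta(t)}$; $V_t=H_0(\Sigma_{u,t};\mathbb{F})$ for $t>0$ (all higher homology vanishes), $V_t=0$ for $t\le0$, and $\pi_{s,t}$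 is induced by the inclusion for $0<s\le t$. *)

theory Defs
  imports "HOL-Analysis.Analysis" "HOL-Homology.Simplices" "HOL-Algebra.AbelCoset" "HOL-Algebra.Module"
begin

section \<open>Inner functions and Blaschke products\<close>

text \<open>
  Functions on the open unit disk are total functions on \<open>complex\<close> of which only the values on
  \<open>ball 0 1\<close> matter.
\<close>

definition inner_function :: "(complex \<Rightarrow> complex) \<Rightarrow> bool" where
  "inner_function u \<longleftrightarrow>
     u holomorphic_on ball 0 1 \<and> bounded (u ` ball 0 1) \<and>
     (AE t in lebesgue_on {0..2*pi}.
        \<exists>w. norm w = 1 \<and> ((\<lambda>r. u (complex_of_real r * cis t)) \<longlongrightarrow> w) (at_left 1))"

definition blaschke_factor :: "complex \<Rightarrow> complex \<Rightarrow> complex" where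
  "blaschke_factor a z = (complex_of_real (norm a) / a) * ((a - z) / (1 - cnj a * z))"

text \<open>
  The number \<open>N\<close> of nonzero zeros, counted with multiplicity, is finite or \<open>\<infinity>\<close>; the sequence of
  zeros is \<open>\<alpha> n\<close> for \<open>n < N\<close>, and the remaining factors of the product are 1.
\<close>

definition blaschke_product :: "(complex \<Rightarrow> complex) \<Rightarrow> bool" where
  "blaschke_product B \<longleftrightarrow> inner_function B \<and>
     (\<exists>(c::complex) (m::nat) (N::enat) (\<alpha>::nat \<Rightarrow> complex).
        norm c = 1 \<and>
        (\<forall>n. enat n < N \<longrightarrow> \<alpha> n \<in> ball 0 1 - {0}) \<and>
        summable (\<lambda>n. if enat n < N then 1 - norm (\<alpha> n) else 0) \<and>
        (\<forall>z\<in>ball 0 1.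
           B z = c * z ^ m * prodinf (\<lambda>n. if enat n < N then blaschke_factor (\<alpha> n) z else 1)))"

definition disk_sup_norm :: "(complex \<Rightarrow> complex) \<Rightarrow> real" where
  "disk_sup_norm f = (SUP z\<in>ball 0 1. norm (f z))"

definition sublevel :: "(complex \<Rightarrow> complex) \<Rightarrow> real \<Rightarrow> complex set" where
  "sublevel u \<theta> = {z \<in> ball 0 1. norm (u z) < \<theta>}"

definition pseudohyp_dist :: "complex \<Rightarrow> complex \<Rightarrow> real" where
  "pseudohyp_dist z\<^sub>1 z\<^sub>2 = norm ((z\<^sub>1 - z\<^sub>2) / (1 - cnj z\<^sub>1 * z\<^sub>2))"

text \<open>
  The supremum is taken in \<open>[0,1]\<close>; inserting \<open>0\<close> only matters when the sublevel set is empty.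
\<close>

definition component_diam :: "(complex \<Rightarrow> complex) \<Rightarrow> real \<Rightarrow> real" where
  "component_diam u \<eta> =
     Sup (insert 0 {pseudohyp_dist z\<^sub>1 z\<^sub>2 | z\<^sub>1 z\<^sub>2.
                      \<exists>C\<in>components (sublevel u \<eta>). z\<^sub>1 \<in> C \<and> z\<^sub>2 \<in> C})"

definition property_B :: "(complex \<Rightarrow> complex) \<Rightarrow> bool" where
  "property_B u \<longleftrightarrow> (\<forall>\<theta>\<in>{0<..<1}. \<forall>C\<in>components (sublevel u \<theta>). closure C \<subseteq> ball 0 1)"

definition strong_property_B :: "(complex \<Rightarrow> complex) \<Rightarrow> bool" where
  "strong_property_B u \<longleftrightarrow> property_B u \<and> (\<exists>\<eta>\<in>{0<..<1}. component_diam u \<eta> < 1)"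


section \<open>Persistence modules\<close>

text \<open>
  Vector spaces over a field \<open>F\<close> are modules over \<open>F\<close> in the sense of HOL-Algebra. Their records also
  have the ring components \<open>mult\<close> and \<open>one\<close>, which play no role.
\<close>

definition linear_maps ::
  "('k,'m) ring_scheme \<Rightarrow> ('k,'v) module \<Rightarrow> ('k,'w) module \<Rightarrow> ('v \<Rightarrow> 'w) set" where
  "linear_maps F M N =
     {h \<in> hom (add_monoid M) (add_monoid N).
        \<forall>a\<in>carrier F. \<forall>x\<in>carrier M. h (a \<odot>\<^bsub>M\<^esub> x) = a \<odot>\<^bsub>N\<^esub> h x}"

record ('k,'v) persistence =
  pspace :: "real \<Rightarrow> ('k,'v) module"
  pmap :: "real \<Rightarrow> real \<Rightarrow> 'v \<Rightarrow> 'v"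

locale persistence_module =
  fixes F :: "('k,'m) ring_scheme" and V :: "('k,'v) persistence"
  assumes field: "field F"
    and pspace: "\<And>t. module F (pspace V t)"
    and pmap_linear: "\<And>s t. s \<le> t \<Longrightarrow> pmap V s t \<in> linear_maps F (pspace V s) (pspace V t)"
    and pmap_comp: "\<And>s t r x. \<lbrakk>s \<le> t; t \<le> r; x \<in> carrier (pspace V s)\<rbrakk> \<Longrightarrow>
                      pmap V s r x = pmap V t r (pmap V s t x)"
    and pmap_id: "\<And>t x. x \<in> carrier (pspace V t) \<Longrightarrow> pmap V t t x = x"
    and zero_below: "\<exists>s\<^sub>0. \<forall>s\<le>s\<^sub>0. carrier (pspace V s) = {\<zero>\<^bsub>pspace V s\<^esub>}"

definition persistence_hom ::
  "('k,'m) ring_scheme \<Rightarrow> ('k,'v) persistence \<Rightarrow> ('k,'w) persistence \<Rightarrow> (real \<Rightarrow> 'v \<Rightarrow> 'w) \<Rightarrow> bool"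
  where
  "persistence_hom F V W \<phi> \<longleftrightarrow>
     (\<forall>t. \<phi> t \<in> linear_maps F (pspace V t) (pspace W t)) \<and>
     (\<forall>s t. s \<le> t \<longrightarrow> (\<forall>x\<in>carrier (pspace V s). \<phi> t (pmap V s t x) = pmap W s t (\<phi> s x)))"

definition pshift :: "real \<Rightarrow> ('k,'v) persistence \<Rightarrow> ('k,'v) persistence" where
  "pshift \<Delta> V = \<lparr>pspace = (\<lambda>t. pspace V (t + \<Delta>)), pmap = (\<lambda>s t. pmap V (s + \<Delta>) (t + \<Delta>))\<rparr>"

definition hom_shift :: "real \<Rightarrow> (real \<Rightarrow> 'v \<Rightarrow> 'w) \<Rightarrow> real \<Rightarrow> 'v \<Rightarrow> 'w" where
  "hom_shift \<Delta> \<phi> t = \<phi> (t + \<Delta>)"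

definition shift_hom :: "real \<Rightarrow> ('k,'v) persistence \<Rightarrow> real \<Rightarrow> 'v \<Rightarrow> 'v" where
  "shift_hom \<Delta> V t = pmap V t (t + \<Delta>)"

definition interleaved ::
  "('k,'m) ring_scheme \<Rightarrow> real \<Rightarrow> ('k,'v) persistence \<Rightarrow> ('k,'w) persistence \<Rightarrow> bool" where
  "interleaved F \<Delta> V W \<longleftrightarrow>
     (\<exists>\<phi> \<psi>. persistence_hom F V (pshift \<Delta> W) \<phi> \<and> persistence_hom F W (pshift \<Delta> V) \<psi> \<and>
        (\<forall>t. \<forall>x\<in>carrier (pspace V t). hom_shift \<Delta> \<psi> t (\<phi> t x) = shift_hom (2 * \<Delta>) V t x) \<and>
        (\<forall>t. \<forall>y\<in>carrier (pspace W t). hom_shift \<Delta> \<phi> t (\<psi> t y) = shift_hom (2 * \<Delta>) W t y))"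

text \<open>The value is \<open>\<infinity>\<close> if the modules are not interleaved at all.\<close>

definition interleaving_dist ::
  "('k,'m) ring_scheme \<Rightarrow> ('k,'v) persistence \<Rightarrow> ('k,'w) persistence \<Rightarrow> ereal" where
  "interleaving_dist F V W = (INF \<Delta>\<in>{\<Delta>. 0 < \<Delta> \<and> interleaved F \<Delta> V W}. ereal \<Delta>)"


section \<open>Singular homology with coefficients in a field\<close>

text \<open>
  The singular homology groups of HOL-Homology have integer coefficients. Here a singular chain with
  coefficients in \<open>F\<close> is a finitely supported \<open>F\<close>-valued function on the singular simplices of that
  library.
\<close>

type_synonym ('k,'a) coeff_chain = "((nat \<Rightarrow> real) \<Rightarrow> 'a) \<Rightarrow> 'k"

definition chain_space ::
  "('k,'m) ring_scheme \<Rightarrow> nat \<Rightarrow> 'a topology \<Rightarrow> ('k, ('k,'a) coeff_chain) module" where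
  "chain_space F p X =
     \<lparr>carrier = {c. (\<forall>f. c f \<in> carrier F) \<and> finite {f. c f \<noteq> \<zero>\<^bsub>F\<^esub>} \<and>
                     (\<forall>f. c f \<noteq> \<zero>\<^bsub>F\<^esub> \<longrightarrow> singular_simplex p X f)},
      mult = undefined, one = undefined,
      zero = (\<lambda>f. \<zero>\<^bsub>F\<^esub>), add = (\<lambda>c d f. c f \<oplus>\<^bsub>F\<^esub> d f),
      smult = (\<lambda>a c f. a \<otimes>\<^bsub>F\<^esub> c f)\<rparr>"

text \<open>
  This is the linear extension of the map sending a \<open>p\<close>-simplex \<open>f\<close> to the sum over \<open>k \<le> p\<close> of
  \<open>(-1) ^ k\<close> times its \<open>k\<close>-th face, written as the coefficient of the \<open>(p-1)\<close>-simplex \<open>g\<close>; as for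
  \<^const>\<open>chain_boundary\<close> it is zero in degree 0.
\<close>

definition coeff_boundary ::
  "('k,'m) ring_scheme \<Rightarrow> nat \<Rightarrow> ('k,'a) coeff_chain \<Rightarrow> ('k,'a) coeff_chain" where
  "coeff_boundary F p c g =
     (if p = 0 then \<zero>\<^bsub>F\<^esub>
      else (\<Oplus>\<^bsub>F\<^esub> k \<in> {..p}.
              \<Oplus>\<^bsub>F\<^esub> f \<in> {f. c f \<noteq> \<zero>\<^bsub>F\<^esub> \<and> singular_face p k f = g}.
                if even k then c f else \<ominus>\<^bsub>F\<^esub> c f))"

definition cycle_space ::
  "('k,'m) ring_scheme \<Rightarrow> nat \<Rightarrow> 'a topology \<Rightarrow> ('k, ('k,'a) coeff_chain) module" where
  "cycle_space F p X = (chain_space F p X)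
     \<lparr>carrier := {c \<in> carrier (chain_space F p X). coeff_boundary F p c = (\<lambda>g. \<zero>\<^bsub>F\<^esub>)}\<rparr>"

definition boundaries ::
  "('k,'m) ring_scheme \<Rightarrow> nat \<Rightarrow> 'a topology \<Rightarrow> ('k,'a) coeff_chain set" where
  "boundaries F p X = coeff_boundary F (Suc p) ` carrier (chain_space F (Suc p) X)"

definition quotient_space :: "('k,'v) module \<Rightarrow> 'v set \<Rightarrow> ('k, 'v set) module" where
  "quotient_space M N =
     \<lparr>carrier = a_rcosets\<^bsub>M\<^esub> N, mult = undefined, one = undefined,
      zero = N, add = set_add M,
      smult = (\<lambda>a K. \<Union>x\<in>K. N +>\<^bsub>M\<^esub> (a \<odot>\<^bsub>M\<^esub> x))\<rparr>"

definition homology_space ::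
  "('k,'m) ring_scheme \<Rightarrow> nat \<Rightarrow> 'a topology \<Rightarrow> ('k, ('k,'a) coeff_chain set) module" where
  "homology_space F p X = quotient_space (cycle_space F p X) (boundaries F p X)"

text \<open>
  If \<open>X\<close> is a subspace of \<open>Y\<close>, every singular chain of \<open>X\<close> is one of \<open>Y\<close>, so the inclusion sends the
  class of a cycle \<open>c\<close> in \<open>X\<close> to the class of \<open>c\<close> in \<open>Y\<close>.
\<close>

definition homology_inclusion ::
  "('k,'m) ring_scheme \<Rightarrow> nat \<Rightarrow> 'a topology \<Rightarrow>
   ('k,'a) coeff_chain set \<Rightarrow> ('k,'a) coeff_chain set" where
  "homology_inclusion F p Y K = (\<Union>c\<in>K. boundaries F p Y +>\<^bsub>cycle_space F p Y\<^esub> c)"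


section \<open>The persistence module of an inner function\<close>

definition zero_space :: "('k,'v) module" where
  "zero_space = \<lparr>carrier = {undefined}, mult = undefined, one = undefined,
     zero = undefined, add = (\<lambda>x y. undefined), smult = (\<lambda>a x. undefined)\<rparr>"

definition level :: "real \<Rightarrow> real" where
  "level t = (exp t - 1) / (exp t + 1)"

definition inner_space ::
  "('k,'m) ring_scheme \<Rightarrow> (complex \<Rightarrow> complex) \<Rightarrow> real \<Rightarrow>
   ('k, ('k,complex) coeff_chain set) module" where
  "inner_space F u t =
     (if 0 < t then homology_space F 0 (top_of_set (sublevel u (level t))) else zero_space)"

definition inner_persistence ::
  "('k,'m) ring_scheme \<Rightarrow> (complex \<Rightarrow> complex) \<Rightarrow> ('k, ('k,complex) coeff_chain set) persistence"
  where
  "inner_persistence F u =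
     \<lparr>pspace = inner_space F u,
      pmap = (\<lambda>s t. if 0 < s then homology_inclusion F 0 (top_of_set (sublevel u (level t)))
                     else (\<lambda>_. \<zero>\<^bsub>inner_space F u t\<^esub>))\<rparr>"


section \<open>The persistence module of an inner function is a persistence module\<close>

lemma quotient_smult:
  assumes "module F M" "submodule N F M" "a \<in> carrier F" "x \<in> carrier M"
  shows "(\<Union>y\<in>N +>\<^bsub>M\<^esub> x. N +>\<^bsub>M\<^esub> (a \<odot>\<^bsub>M\<^esub> y)) = N +>\<^bsub>M\<^esub> (a \<odot>\<^bsub>M\<^esub> x)"
proof -
  interpret M: module F M by fact
  interpret N: submodule N F M by fact
  have sub: "N \<subseteq> carrier M" "subgroup N (add_monoid M)"
    using N.subset N.subgroup_axioms by auto
  have eq: "N +>\<^bsub>M\<^esub> (a \<odot>\<^bsub>M\<^esub> y) = N +>\<^bsub>M\<^esub> (a \<odot>\<^bsub>M\<^esub> x)" if y: "y \<in> N +>\<^bsub>M\<^esub> x" for y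
  proof -
    obtain n where n: "n \<in> N" "y = n \<oplus>\<^bsub>M\<^esub> x" using y by (auto simp: a_r_coset_def')
    then have "n \<in> carrier M" using sub by auto
    then have "a \<odot>\<^bsub>M\<^esub> y = a \<odot>\<^bsub>M\<^esub> n \<oplus>\<^bsub>M\<^esub> a \<odot>\<^bsub>M\<^esub> x"
      using n assms M.smult_r_distr by simp
    moreover have "a \<odot>\<^bsub>M\<^esub> n \<in> N" using n assms by simp
    ultimately have "a \<odot>\<^bsub>M\<^esub> y \<in> N +>\<^bsub>M\<^esub> (a \<odot>\<^bsub>M\<^esub> x)"
      using M.a_rcosI[of "a \<odot>\<^bsub>M\<^esub> n" N "a \<odot>\<^bsub>M\<^esub> x"] sub assms by simp
    then show ?thesis
      using M.a_repr_independence sub assms by (metis M.smult_closed)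
  qed
  have "x \<in> N +>\<^bsub>M\<^esub> x"
    using M.a_rcosI[of "\<zero>\<^bsub>M\<^esub>" N x] sub assms N.one_closed by simp
  with eq show ?thesis by blast
qed

lemma quotient_module:
  assumes "module F M" "submodule N F M"
  shows "module F (quotient_space M N)"
proof -
  interpret M: module F M by fact
  interpret N: submodule N F M by fact
  interpret N: abelian_subgroup N M
    by (intro abelian_subgroupI3 additive_subgroup.intro N.subgroup_axioms M.abelian_group_axioms)
  have sub: "N \<subseteq> carrier M" "subgroup N (add_monoid M)"
    using N.subset N.subgroup_axioms by auto
  have car: "carrier (quotient_space M N) = (\<lambda>x. N +>\<^bsub>M\<^esub> x) ` carrier M"
    by (auto simp: quotient_space_def A_RCOSETS_def')
  have sm: "a \<odot>\<^bsub>quotient_space M N\<^esub> (N +>\<^bsub>M\<^esub> x) = N +>\<^bsub>M\<^esub> (a \<odot>\<^bsub>M\<^esub> x)"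
    if "a \<in> carrier F" "x \<in> carrier M" for a x
    using quotient_smult[OF assms that] by (simp add: quotient_space_def)
  have ad: "(N +>\<^bsub>M\<^esub> x) \<oplus>\<^bsub>quotient_space M N\<^esub> (N +>\<^bsub>M\<^esub> y) = N +>\<^bsub>M\<^esub> (x \<oplus>\<^bsub>M\<^esub> y)"
    if "x \<in> carrier M" "y \<in> carrier M" for x y
    using N.a_rcos_sum[OF that] by (simp add: quotient_space_def)
  have z: "\<zero>\<^bsub>quotient_space M N\<^esub> = N +>\<^bsub>M\<^esub> \<zero>\<^bsub>M\<^esub>"
    using M.a_coset_add_zero[OF sub(1)] by (simp add: quotient_space_def)
  show ?thesis
  proof (rule moduleI)
    show "cring F" by (rule M.R.cring_axioms)
    show "abelian_group (quotient_space M N)"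
    proof (rule abelian_groupI)
      fix K assume "K \<in> carrier (quotient_space M N)"
      then obtain x where x: "x \<in> carrier M" "K = N +>\<^bsub>M\<^esub> x" using car by auto
      show "\<exists>L\<in>carrier (quotient_space M N). L \<oplus>\<^bsub>quotient_space M N\<^esub> K = \<zero>\<^bsub>quotient_space M N\<^esub>"
        by (rule bexI[of _ "N +>\<^bsub>M\<^esub> (\<ominus>\<^bsub>M\<^esub> x)"]) (auto simp: x ad z car M.l_neg)
    qed (auto simp: car ad z M.a_assoc, simp_all add: M.a_comm)
  qed (auto simp: car ad sm M.smult_l_distr M.smult_r_distr M.smult_assoc1)
qed

lemma chain_module:
  assumes "field F"
  shows "module F (chain_space F p X)"
proof -
  interpret F: field F by fact
  have fin: "finite {f. c f \<oplus>\<^bsub>F\<^esub> d f \<noteq> \<zero>\<^bsub>F\<^esub>}"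
    if "finite {f. c f \<noteq> \<zero>\<^bsub>F\<^esub>}" "finite {f. d f \<noteq> \<zero>\<^bsub>F\<^esub>}" for c d :: "((nat \<Rightarrow> real) \<Rightarrow> 'c) \<Rightarrow> 'a"
    by (rule finite_subset[OF _ finite_UnI[OF that]]) auto
  have fin2: "finite {f. a \<otimes>\<^bsub>F\<^esub> c f \<noteq> \<zero>\<^bsub>F\<^esub>}"
    if "finite {f. c f \<noteq> \<zero>\<^bsub>F\<^esub>}" "a \<in> carrier F" for a and c :: "((nat \<Rightarrow> real) \<Rightarrow> 'c) \<Rightarrow> 'a"
    by (rule finite_subset[OF _ that(1)]) (use that(2) in auto)
  show ?thesis
  proof (rule moduleI)
    show "cring F" by (rule F.cring_axioms)
    show "abelian_group (chain_space F p X)"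
    proof (rule abelian_groupI)
      fix c assume c: "c \<in> carrier (chain_space F p X)"
      have c': "c f \<in> carrier F" for f using c by (auto simp: chain_space_def)
      have n0: "\<ominus>\<^bsub>F\<^esub> c f = \<zero>\<^bsub>F\<^esub> \<longleftrightarrow> c f = \<zero>\<^bsub>F\<^esub>" for f
        using c' by (metis F.minus_minus F.minus_zero)
      show "\<exists>d\<in>carrier (chain_space F p X). d \<oplus>\<^bsub>chain_space F p X\<^esub> c = \<zero>\<^bsub>chain_space F p X\<^esub>"
        by (rule bexI[of _ "\<lambda>f. \<ominus>\<^bsub>F\<^esub> c f"]) (use c c' in \<open>auto simp: chain_space_def F.l_neg n0\<close>)
    next
      fix c d assume "c \<in> carrier (chain_space F p X)" "d \<in> carrier (chain_space F p X)"
      then show "c \<oplus>\<^bsub>chain_space F p X\<^esub> d \<in> carrier (chain_space F p X)"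
        by (auto simp: chain_space_def fin) (metis F.r_zero F.zero_closed)
    qed (auto simp: chain_space_def F.a_assoc, simp add: F.a_comm)
  next
    fix a c assume "a \<in> carrier F" "c \<in> carrier (chain_space F p X)"
    then show "a \<odot>\<^bsub>chain_space F p X\<^esub> c \<in> carrier (chain_space F p X)"
      by (auto simp: chain_space_def fin2) (metis F.r_null)
  qed (auto simp: chain_space_def F.l_distr F.r_distr F.m_assoc)
qed

definition sgn_coeff where "sgn_coeff F k x = (if even (k::nat) then x else \<ominus>\<^bsub>F\<^esub> x)"

lemma boundary_alt:
  assumes "field F" "c \<in> carrier (chain_space F q X)" "finite S" "{f. c f \<noteq> \<zero>\<^bsub>F\<^esub>} \<subseteq> S"
  shows "coeff_boundary F (Suc p) c g =
    (\<Oplus>\<^bsub>F\<^esub> k \<in> {..Suc p}. \<Oplus>\<^bsub>F\<^esub> f \<in> {f\<in>S. singular_face (Suc p) k f = g}. sgn_coeff F k (c f))"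
proof -
  interpret F: field F by fact
  have c: "c f \<in> carrier F" for f using assms by (auto simp: chain_space_def)
  show ?thesis
    unfolding coeff_boundary_def sgn_coeff_def if_not_P[OF Suc_not_Zero]
  proof (rule F.add.finprod_cong')
    fix k
    show "(\<Oplus>\<^bsub>F\<^esub> f \<in> {f. c f \<noteq> \<zero>\<^bsub>F\<^esub> \<and> singular_face (Suc p) k f = g}. if even k then c f else \<ominus>\<^bsub>F\<^esub> c f) =
       (\<Oplus>\<^bsub>F\<^esub> f \<in> {f\<in>S. singular_face (Suc p) k f = g}. if even k then c f else \<ominus>\<^bsub>F\<^esub> c f)"
      by (rule F.add.finprod_mono_neutral_cong_left) (use assms c in auto)
  qed (auto simp: c intro!: F.finsum_closed)
qed

lemma boundary_0: "coeff_boundary F 0 c = (\<lambda>g. \<zero>\<^bsub>F\<^esub>)"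
  by (simp add: coeff_boundary_def fun_eq_iff)

lemma cycle_space_0: "cycle_space F 0 X = chain_space F 0 X"
  by (simp add: cycle_space_def boundary_0)

lemma boundary_chain:
  assumes "field F" "c \<in> carrier (chain_space F (Suc p) X)"
  shows "coeff_boundary F (Suc p) c \<in> carrier (chain_space F p X)"
proof -
  interpret F: field F by fact
  let ?S = "{f. c f \<noteq> \<zero>\<^bsub>F\<^esub>}"
  have c: "c f \<in> carrier F" for f using assms by (auto simp: chain_space_def)
  have S: "finite ?S" using assms by (auto simp: chain_space_def)
  have cl: "coeff_boundary F (Suc p) c g \<in> carrier F" for g
    unfolding boundary_alt[OF assms S order_refl]
    by (auto simp: sgn_coeff_def c intro!: F.finsum_closed)
  have im: "g \<in> (\<lambda>(k,f). singular_face (Suc p) k f) ` ({..Suc p} \<times> ?S)"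
    if "coeff_boundary F (Suc p) c g \<noteq> \<zero>\<^bsub>F\<^esub>" for g
  proof (rule ccontr)
    assume n: "\<not> ?thesis"
    have "coeff_boundary F (Suc p) c g = (\<Oplus>\<^bsub>F\<^esub> k \<in> {..Suc p}. \<zero>\<^bsub>F\<^esub>)"
      unfolding boundary_alt[OF assms S order_refl]
    proof (rule F.add.finprod_cong')
      fix k assume "k \<in> {..Suc p}"
      then have "{f\<in>?S. singular_face (Suc p) k f = g} = {}" using n by auto
      then show "(\<Oplus>\<^bsub>F\<^esub> f \<in> {f\<in>?S. singular_face (Suc p) k f = g}. sgn_coeff F k (c f)) = \<zero>\<^bsub>F\<^esub>"
        by (metis F.finsum_empty)
    qed auto
    then show False using that by simp
  qed
  have "finite {g. coeff_boundary F (Suc p) c g \<noteq> \<zero>\<^bsub>F\<^esub>}"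
    by (rule finite_subset[of _ "(\<lambda>(k,f). singular_face (Suc p) k f) ` ({..Suc p} \<times> ?S)"])
      (use im S in auto)
  moreover have "singular_simplex p X g" if "coeff_boundary F (Suc p) c g \<noteq> \<zero>\<^bsub>F\<^esub>" for g
    using im[OF that] assms(2) singular_simplex_singular_face[of "Suc p" X]
    by (auto simp: chain_space_def)
  ultimately show ?thesis using cl by (auto simp: chain_space_def)
qed

lemma boundary_add:
  assumes "field F" "c \<in> carrier (chain_space F (Suc p) X)" "d \<in> carrier (chain_space F (Suc p) X)"
  shows "coeff_boundary F (Suc p) (c \<oplus>\<^bsub>chain_space F (Suc p) X\<^esub> d) =
     coeff_boundary F (Suc p) c \<oplus>\<^bsub>chain_space F p X\<^esub> coeff_boundary F (Suc p) d"
proof -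
  interpret F: field F by fact
  interpret C: module F "chain_space F (Suc p) X" using chain_module assms by blast
  let ?S = "{f. c f \<noteq> \<zero>\<^bsub>F\<^esub>} \<union> {f. d f \<noteq> \<zero>\<^bsub>F\<^esub>}"
  have c: "c f \<in> carrier F" "d f \<in> carrier F" for f using assms by (auto simp: chain_space_def)
  have S: "finite ?S" using assms by (auto simp: chain_space_def)
  have cd: "c \<oplus>\<^bsub>chain_space F (Suc p) X\<^esub> d \<in> carrier (chain_space F (Suc p) X)"
    using assms by simp
  have sub: "{f. (c \<oplus>\<^bsub>chain_space F (Suc p) X\<^esub> d) f \<noteq> \<zero>\<^bsub>F\<^esub>} \<subseteq> ?S"
    by (auto simp: chain_space_def)
  have sg: "sgn_coeff F k (c f \<oplus>\<^bsub>F\<^esub> d f) = sgn_coeff F k (c f) \<oplus>\<^bsub>F\<^esub> sgn_coeff F k (d f)" for k f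
    using c by (simp add: sgn_coeff_def F.minus_add)
  show ?thesis
    apply (rule ext)
    unfolding boundary_alt[OF assms(1) cd S sub]
    apply (simp add: chain_space_def sg)
    apply (subst boundary_alt[OF assms(1,2) S]) apply blast
    apply (subst boundary_alt[OF assms(1,3) S]) apply blast
    by (simp add: F.finsum_addf Pi_def F.finsum_closed sgn_coeff_def c S)
qed

lemma boundary_smult:
  assumes "field F" "a \<in> carrier F" "c \<in> carrier (chain_space F (Suc p) X)"
  shows "coeff_boundary F (Suc p) (a \<odot>\<^bsub>chain_space F (Suc p) X\<^esub> c) =
     a \<odot>\<^bsub>chain_space F p X\<^esub> coeff_boundary F (Suc p) c"
proof -
  interpret F: field F by fact
  interpret C: module F "chain_space F (Suc p) X" using chain_module assms by blast
  let ?S = "{f. c f \<noteq> \<zero>\<^bsub>F\<^esub>}"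
  have c: "c f \<in> carrier F" for f using assms by (auto simp: chain_space_def)
  have S: "finite ?S" using assms by (auto simp: chain_space_def)
  have cd: "a \<odot>\<^bsub>chain_space F (Suc p) X\<^esub> c \<in> carrier (chain_space F (Suc p) X)"
    using assms by simp
  have sub: "{f. (a \<odot>\<^bsub>chain_space F (Suc p) X\<^esub> c) f \<noteq> \<zero>\<^bsub>F\<^esub>} \<subseteq> ?S"
    using assms by (auto simp: chain_space_def)
  have sg: "sgn_coeff F k (a \<otimes>\<^bsub>F\<^esub> c f) = a \<otimes>\<^bsub>F\<^esub> sgn_coeff F k (c f)" for k f
    using c assms by (simp add: sgn_coeff_def F.r_minus)
  show ?thesis
    apply (rule ext)
    unfolding boundary_alt[OF assms(1) cd S sub]
    apply (simp add: chain_space_def sg)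
    apply (subst boundary_alt[OF assms(1,3) S]) apply blast
    by (simp del: F.finsum_Suc add: F.finsum_rdistr Pi_def sgn_coeff_def c S assms(2) F.finsum_closed)
qed

lemma boundaries_submodule:
  assumes "field F"
  shows "submodule (boundaries F p X) F (chain_space F p X)"
proof -
  interpret F: field F by fact
  interpret C: module F "chain_space F p X" using chain_module assms by blast
  interpret D: module F "chain_space F (Suc p) X" using chain_module assms by blast
  have sm: "a \<odot>\<^bsub>chain_space F p X\<^esub> x \<in> boundaries F p X"
    if as: "a \<in> carrier F" "x \<in> boundaries F p X" for a x
  proof -
    obtain c where c: "x = coeff_boundary F (Suc p) c" "c \<in> carrier (chain_space F (Suc p) X)"
      using as(2) unfolding boundaries_def by (rule imageE)
    then show ?thesis
      unfolding boundaries_def using boundary_smult[OF assms as(1) c(2)] as(1)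
      by (intro image_eqI[of _ _ "a \<odot>\<^bsub>chain_space F (Suc p) X\<^esub> c"]) auto
  qed
  have ad: "x \<oplus>\<^bsub>chain_space F p X\<^esub> y \<in> boundaries F p X"
    if xy: "x \<in> boundaries F p X" "y \<in> boundaries F p X" for x y
  proof -
    obtain c where c: "x = coeff_boundary F (Suc p) c" "c \<in> carrier (chain_space F (Suc p) X)"
      using xy(1) unfolding boundaries_def by (rule imageE)
    moreover obtain d where d: "y = coeff_boundary F (Suc p) d" "d \<in> carrier (chain_space F (Suc p) X)"
      using xy(2) unfolding boundaries_def by (rule imageE)
    ultimately show ?thesis
      unfolding boundaries_def using boundary_add[OF assms c(2) d(2)]
      by (intro image_eqI[of _ _ "c \<oplus>\<^bsub>chain_space F (Suc p) X\<^esub> d"]) auto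
  qed
  show ?thesis
  proof (rule C.submoduleI)
    show s: "boundaries F p X \<subseteq> carrier (chain_space F p X)"
      using boundary_chain[OF assms] by (auto simp: boundaries_def)
    have "coeff_boundary F (Suc p) \<zero>\<^bsub>chain_space F (Suc p) X\<^esub> \<in> boundaries F p X"
      unfolding boundaries_def by (rule imageI) (rule D.zero_closed)
    from sm[OF F.zero_closed this] C.smult_l_null[OF subsetD[OF s this]]
    show "\<zero>\<^bsub>chain_space F p X\<^esub> \<in> boundaries F p X" by metis
    show "\<ominus>\<^bsub>chain_space F p X\<^esub> x \<in> boundaries F p X" if x: "x \<in> boundaries F p X" for x
    proof -
      have xc: "x \<in> carrier (chain_space F p X)" using s x by (rule subsetD)
      have "(\<ominus>\<^bsub>F\<^esub> \<one>\<^bsub>F\<^esub>) \<odot>\<^bsub>chain_space F p X\<^esub> x = \<ominus>\<^bsub>chain_space F p X\<^esub> x"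
        unfolding C.smult_l_minus[OF F.one_closed xc] C.smult_one[OF xc] ..
      with sm[OF F.a_inv_closed[OF F.one_closed] x] show ?thesis by metis
    qed
  qed (fact ad sm)+
qed

lemma homology_0_module:
  assumes "field F"
  shows "module F (homology_space F 0 X)"
  unfolding homology_space_def cycle_space_0
  by (intro quotient_module chain_module boundaries_submodule assms)

lemma homology_0_carrier:
  "carrier (homology_space F 0 X) =
     (\<lambda>c. boundaries F 0 X +>\<^bsub>chain_space F 0 X\<^esub> c) ` carrier (chain_space F 0 X)"
  by (auto simp: homology_space_def quotient_space_def cycle_space_0 A_RCOSETS_def')

lemma chain_space_mono:
  assumes "A \<subseteq> B"
  shows "carrier (chain_space F p (top_of_set A)) \<subseteq> carrier (chain_space F p (top_of_set B))"
  using assms singular_simplex_mono[OF _ assms] by (auto simp: chain_space_def)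

lemma chain_ops:
  "add (chain_space F p X) = add (chain_space F q Y)"
  "smult (chain_space F p X) = smult (chain_space F q Y)"
  "zero (chain_space F p X) = zero (chain_space F q Y)"
  by (simp_all add: chain_space_def)

lemma coset_ops: "N +>\<^bsub>chain_space F p X\<^esub> c = N +>\<^bsub>chain_space F q Y\<^esub> c"
  by (simp add: a_r_coset_def' chain_ops(1)[where F=F and p=p and X=X and q=q and Y=Y])

lemma homology_inclusion_coset:
  assumes "field F" "A \<subseteq> B" "c \<in> carrier (chain_space F 0 (top_of_set A))"
  shows "homology_inclusion F 0 (top_of_set B)
           (boundaries F 0 (top_of_set A) +>\<^bsub>chain_space F 0 X\<^esub> c) =
         boundaries F 0 (top_of_set B) +>\<^bsub>chain_space F 0 Y\<^esub> c"
proof -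
  let ?N = "boundaries F 0 (top_of_set A)" and ?K = "boundaries F 0 (top_of_set B)"
  let ?M = "chain_space F 0 (top_of_set B)"
  interpret M: module F ?M using chain_module assms by blast
  interpret N: submodule ?N F "chain_space F 0 (top_of_set A)" using boundaries_submodule assms by blast
  interpret K: submodule ?K F ?M using boundaries_submodule assms by blast
  have NK: "?N \<subseteq> ?K" using chain_space_mono[OF assms(2)] by (fastforce simp: boundaries_def)
  have cM: "c \<in> carrier ?M" using chain_space_mono assms by blast
  have sub: "?K \<subseteq> carrier ?M" "subgroup ?K (add_monoid ?M)"
    using K.subset K.subgroup_axioms by auto
  have *: "?K +>\<^bsub>?M\<^esub> d = ?K +>\<^bsub>?M\<^esub> c" if "d \<in> ?N +>\<^bsub>?M\<^esub> c" for d
  proof -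
    have "d \<in> ?K +>\<^bsub>?M\<^esub> c" using that NK by (auto simp: a_r_coset_def')
    then show ?thesis using M.a_repr_independence sub cM by metis
  qed
  have z: "\<zero>\<^bsub>?M\<^esub> \<in> ?N" using N.one_closed by (simp add: chain_space_def)
  have "c \<in> ?N +>\<^bsub>?M\<^esub> c"
    using z cM by (force simp: a_r_coset_def')
  with * have "(\<Union>d\<in>?N +>\<^bsub>?M\<^esub> c. ?K +>\<^bsub>?M\<^esub> d) = ?K +>\<^bsub>?M\<^esub> c" by blast
  then show ?thesis
    by (simp add: homology_inclusion_def cycle_space_0 coset_ops[where F=F and p=0 and X=X and q=0 and Y="top_of_set B"]
        coset_ops[where F=F and p=0 and X=Y and q=0 and Y="top_of_set B"])
qed

lemma homology_ops:
  assumes "field F" "c \<in> carrier (chain_space F 0 X)" "d \<in> carrier (chain_space F 0 X)" "a \<in> carrier F"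
  shows "(boundaries F 0 X +>\<^bsub>chain_space F 0 X\<^esub> c) \<oplus>\<^bsub>homology_space F 0 X\<^esub>
           (boundaries F 0 X +>\<^bsub>chain_space F 0 X\<^esub> d) =
         boundaries F 0 X +>\<^bsub>chain_space F 0 X\<^esub> (c \<oplus>\<^bsub>chain_space F 0 X\<^esub> d)"
    and "a \<odot>\<^bsub>homology_space F 0 X\<^esub> (boundaries F 0 X +>\<^bsub>chain_space F 0 X\<^esub> c) =
         boundaries F 0 X +>\<^bsub>chain_space F 0 X\<^esub> (a \<odot>\<^bsub>chain_space F 0 X\<^esub> c)"
proof -
  interpret M: module F "chain_space F 0 X" using chain_module assms by blast
  interpret N: submodule "boundaries F 0 X" F "chain_space F 0 X" using boundaries_submodule assms by blast
  interpret N: abelian_subgroup "boundaries F 0 X" "chain_space F 0 X"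
    by (intro abelian_subgroupI3 additive_subgroup.intro N.subgroup_axioms M.abelian_group_axioms)
  show "(boundaries F 0 X +>\<^bsub>chain_space F 0 X\<^esub> c) \<oplus>\<^bsub>homology_space F 0 X\<^esub>
           (boundaries F 0 X +>\<^bsub>chain_space F 0 X\<^esub> d) =
         boundaries F 0 X +>\<^bsub>chain_space F 0 X\<^esub> (c \<oplus>\<^bsub>chain_space F 0 X\<^esub> d)"
    using N.a_rcos_sum assms by (simp add: homology_space_def quotient_space_def cycle_space_0)
  show "a \<odot>\<^bsub>homology_space F 0 X\<^esub> (boundaries F 0 X +>\<^bsub>chain_space F 0 X\<^esub> c) =
         boundaries F 0 X +>\<^bsub>chain_space F 0 X\<^esub> (a \<odot>\<^bsub>chain_space F 0 X\<^esub> c)"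
    using quotient_smult[OF M.module_axioms N.submodule_axioms] assms
    by (simp add: homology_space_def quotient_space_def cycle_space_0)
qed

lemma homology_inclusion_linear:
  assumes "field F" "A \<subseteq> B"
  shows "homology_inclusion F 0 (top_of_set B) \<in>
    linear_maps F (homology_space F 0 (top_of_set A)) (homology_space F 0 (top_of_set B))"
proof -
  let ?A = "chain_space F 0 (top_of_set A)" and ?B = "chain_space F 0 (top_of_set B)"
  interpret A: module F ?A using chain_module assms by blast
  interpret B: module F ?B using chain_module assms by blast
  have i: "homology_inclusion F 0 (top_of_set B) (boundaries F 0 (top_of_set A) +>\<^bsub>?A\<^esub> c) =
         boundaries F 0 (top_of_set B) +>\<^bsub>?B\<^esub> c" if "c \<in> carrier ?A" for c
    using homology_inclusion_coset assms that by blast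
  have m: "c \<in> carrier ?B" if "c \<in> carrier ?A" for c using chain_space_mono assms that by blast
  let ?HA = "homology_space F 0 (top_of_set A)" and ?HB = "homology_space F 0 (top_of_set B)"
  let ?h = "homology_inclusion F 0 (top_of_set B)"
  have eqs: "c \<oplus>\<^bsub>?A\<^esub> d = c \<oplus>\<^bsub>?B\<^esub> d" "a \<odot>\<^bsub>?A\<^esub> c = a \<odot>\<^bsub>?B\<^esub> c" for a c d
    by (simp_all add: chain_space_def)
  have "?h K \<in> carrier ?HB" if "K \<in> carrier ?HA" for K
    using that i m by (auto simp: homology_0_carrier)
  moreover have "?h (K \<oplus>\<^bsub>?HA\<^esub> L) = ?h K \<oplus>\<^bsub>?HB\<^esub> ?h L" if KL: "K \<in> carrier ?HA" "L \<in> carrier ?HA" for K L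
  proof -
    obtain c d where c: "c \<in> carrier ?A" "K = boundaries F 0 (top_of_set A) +>\<^bsub>?A\<^esub> c"
      and d: "d \<in> carrier ?A" "L = boundaries F 0 (top_of_set A) +>\<^bsub>?A\<^esub> d"
      using KL unfolding homology_0_carrier by blast
    have "?h (K \<oplus>\<^bsub>?HA\<^esub> L) = boundaries F 0 (top_of_set B) +>\<^bsub>?B\<^esub> (c \<oplus>\<^bsub>?A\<^esub> d)"
      unfolding c(2) d(2) homology_ops(1)[OF assms(1) c(1) d(1) A.R.zero_closed]
      using c d by (intro i A.a_closed)
    also have "\<dots> = ?h K \<oplus>\<^bsub>?HB\<^esub> ?h L"
      unfolding c(2) d(2) i[OF c(1)] i[OF d(1)] eqs
      by (rule homology_ops(1)[OF assms(1) m[OF c(1)] m[OF d(1)] A.R.zero_closed, symmetric])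
    finally show ?thesis .
  qed
  moreover have "?h (a \<odot>\<^bsub>?HA\<^esub> K) = a \<odot>\<^bsub>?HB\<^esub> ?h K" if KL: "a \<in> carrier F" "K \<in> carrier ?HA" for a K
  proof -
    obtain c where c: "c \<in> carrier ?A" "K = boundaries F 0 (top_of_set A) +>\<^bsub>?A\<^esub> c"
      using KL unfolding homology_0_carrier by blast
    have "?h (a \<odot>\<^bsub>?HA\<^esub> K) = boundaries F 0 (top_of_set B) +>\<^bsub>?B\<^esub> (a \<odot>\<^bsub>?A\<^esub> c)"
      unfolding c(2) homology_ops(2)[OF assms(1) c(1) c(1) KL(1)]
      using c KL by (intro i A.smult_closed)
    also have "\<dots> = a \<odot>\<^bsub>?HB\<^esub> ?h K"
      unfolding c(2) i[OF c(1)] eqs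
      by (rule homology_ops(2)[OF assms(1) m[OF c(1)] m[OF c(1)] KL(1), symmetric])
    finally show ?thesis .
  qed
  ultimately show ?thesis
    by (simp add: linear_maps_def hom_def)
qed

lemma level_mono: "s \<le> t \<Longrightarrow> level s \<le> level t"
proof -
  assume "s \<le> t"
  have "level x = 1 - 2 / (exp x + 1)" for x
    unfolding level_def by (simp add: field_simps add_pos_pos less_imp_neq[OF add_pos_pos, symmetric])
  moreover have "2 / (exp t + 1) \<le> 2 / (exp s + 1)"
    using \<open>s \<le> t\<close> by (intro divide_left_mono) (auto simp: add_pos_pos)
  ultimately show ?thesis by simp
qed

lemma sublevel_mono: "s \<le> t \<Longrightarrow> sublevel u (level s) \<subseteq> sublevel u (level t)"
  using level_mono[of s t] by (auto simp: sublevel_def)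

lemma zero_module: "field F \<Longrightarrow> module F zero_space"
proof -
  assume "field F"
  then interpret field F .
  show ?thesis
    by (rule moduleI) (auto simp: zero_space_def cring_axioms intro!: abelian_groupI)
qed

lemma inner_space_module: "field F \<Longrightarrow> module F (inner_space F u t)"
  by (simp add: inner_space_def zero_module homology_0_module)

lemma zero_map_linear:
  assumes "module F N"
  shows "(\<lambda>_. \<zero>\<^bsub>N\<^esub>) \<in> linear_maps F M N"
proof -
  interpret module F N by fact
  show ?thesis by (auto simp: linear_maps_def hom_def)
qed

lemma inner_persistence_module:
  assumes "field F"
  shows "persistence_module F (inner_persistence F u)"
proof (rule persistence_module.intro)
  have [simp]: "pspace (inner_persistence F u) = inner_space F u" by (simp add: inner_persistence_def)
  show "field F" by fact
  show "module F (pspace (inner_persistence F u) t)" for t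
    by (simp add: inner_space_module assms)
  fix s t :: real assume st: "s \<le> t"
  show "pmap (inner_persistence F u) s t
      \<in> linear_maps F (pspace (inner_persistence F u) s) (pspace (inner_persistence F u) t)"
  proof (cases "0 < s")
    case True
    then show ?thesis using st homology_inclusion_linear[OF assms sublevel_mono[OF st, of u]]
      by (simp add: inner_persistence_def inner_space_def)
  next
    case False
    then show ?thesis using zero_map_linear[OF inner_space_module[OF assms, of u t]]
      by (simp add: inner_persistence_def)
  qed
  fix r :: real and x assume tr: "t \<le> r" and x: "x \<in> carrier (pspace (inner_persistence F u) s)"
  show "pmap (inner_persistence F u) s r x =
        pmap (inner_persistence F u) t r (pmap (inner_persistence F u) s t x)"
  proof (cases "0 < s")
    case True
    then obtain c where c: "c \<in> carrier (chain_space F 0 (top_of_set (sublevel u (level s))))"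
      "x = boundaries F 0 (top_of_set (sublevel u (level s))) +>\<^bsub>chain_space F 0 (top_of_set (sublevel u (level s)))\<^esub> c"
      using x by (auto simp: inner_space_def homology_0_carrier)
    have c2: "c \<in> carrier (chain_space F 0 (top_of_set (sublevel u (level t))))"
      using chain_space_mono[OF sublevel_mono[OF st]] c by blast
    note incl = homology_inclusion_coset[OF assms sublevel_mono]
    show ?thesis
      using True st tr
      by (simp add: inner_persistence_def c(2) incl[OF st c(1), where Y=euclidean]
          incl[OF order_trans[OF st tr] c(1), where Y=euclidean] incl[OF tr c2, where Y=euclidean])
  next
    case False
    have lin: "homology_inclusion F 0 (top_of_set (sublevel u (level r))) \<in>
      linear_maps F (homology_space F 0 (top_of_set (sublevel u (level t)))) (homology_space F 0 (top_of_set (sublevel u (level r))))"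
      using homology_inclusion_linear[OF assms sublevel_mono[OF tr]] .
    interpret T: module F "inner_space F u t" by (rule inner_space_module[OF assms])
    interpret R: module F "inner_space F u r" by (rule inner_space_module[OF assms])
    have "homology_inclusion F 0 (top_of_set (sublevel u (level r))) \<zero>\<^bsub>inner_space F u t\<^esub> = \<zero>\<^bsub>inner_space F u r\<^esub>" if "0 < t"
    proof -
      let ?h = "homology_inclusion F 0 (top_of_set (sublevel u (level r)))"
      have h: "?h \<in> linear_maps F (inner_space F u t) (inner_space F u r)"
        using lin that tr by (simp add: inner_space_def)
      have c: "?h \<zero>\<^bsub>inner_space F u t\<^esub> \<in> carrier (inner_space F u r)"
        using h T.M.zero_closed by (auto simp: linear_maps_def hom_def)
      have "?h (\<zero>\<^bsub>F\<^esub> \<odot>\<^bsub>inner_space F u t\<^esub> \<zero>\<^bsub>inner_space F u t\<^esub>) =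
          \<zero>\<^bsub>F\<^esub> \<odot>\<^bsub>inner_space F u r\<^esub> ?h \<zero>\<^bsub>inner_space F u t\<^esub>"
        using h T.R.zero_closed T.M.zero_closed unfolding linear_maps_def by blast
      with c show ?thesis by simp
    qed
    then show ?thesis using False by (simp add: inner_persistence_def)
  qed
next
  fix t x assume x: "x \<in> carrier (pspace (inner_persistence F u) t)"
  show "pmap (inner_persistence F u) t t x = x"
  proof (cases "0 < t")
    case True
    with x obtain c where c: "c \<in> carrier (chain_space F 0 (top_of_set (sublevel u (level t))))"
      "x = boundaries F 0 (top_of_set (sublevel u (level t))) +>\<^bsub>chain_space F 0 (top_of_set (sublevel u (level t)))\<^esub> c"
      by (auto simp: inner_space_def homology_0_carrier inner_persistence_def)
    then show ?thesis using True
      homology_inclusion_coset[OF assms order_refl c(1), of "top_of_set (sublevel u (level t))" "top_of_set (sublevel u (level t))"]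
      by (simp add: inner_persistence_def)
  next
    case False
    then show ?thesis using x by (simp add: inner_persistence_def inner_space_def zero_space_def)
  qed
next
  show "\<exists>s\<^sub>0. \<forall>s\<le>s\<^sub>0. carrier (pspace (inner_persistence F u) s) = {\<zero>\<^bsub>pspace (inner_persistence F u) s\<^esub>}"
    by (rule exI[of _ 0]) (simp add: inner_persistence_def inner_space_def zero_space_def)
qed

end

theory Submission
  imports Defs "HOL-Complex_Analysis.Conformal_Mappings"
begin

text \<open>
  Suppose \<open>|B - B'| \<le> \<eta>\<close> and let \<open>a = level \<Delta>\<close>. On the region \<open>|B'| > a\<close> the functions
  \<open>-ln |B|\<close> and \<open>-ln |B'|\<close> are positive and harmonic; on its boundary inside the disk they are
  comparable with a factor close to 1, because \<open>|B'| = a\<close> and \<open>|B| \<ge> a - \<eta>\<close>, while at the unit circle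
  the partial products of \<open>B\<close> have modulus 1. The maximum principle therefore gives
  \<open>-ln |B| \<le> (1 + 1/q) (-ln |B'|)\<close> on the whole region, where \<open>q\<close> depends only on \<open>\<Delta>\<close>.
  Since \<open>-ln (level t)\<close> decreases at least exponentially in \<open>t\<close>, this turns into an inclusion
  of the sublevel set of \<open>B\<close> at time \<open>t\<close> into that of \<open>B'\<close> at time \<open>t + \<Delta>\<close>, for every \<open>t > 0\<close>.
  The situation is symmetric, and the inclusions induce a \<open>\<Delta>\<close>-interleaving.
\<close>

section \<open>Partial products of a Blaschke product\<close>

lemma blaschke_denominator_pos:
  assumes "norm a < 1" "norm z \<le> 1"
  shows "0 < norm (1 - cnj a * z)"
proof -
  have "norm (cnj a * z) < 1"
    using mult_left_le[OF assms(2), of "norm a"] assms(1) by (simp add: norm_mult)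
  then show ?thesis by auto
qed

lemma norm_blaschke_factor_eq:
  assumes "a \<noteq> 0"
  shows "norm (blaschke_factor a z) = norm (a - z) / norm (1 - cnj a * z)"
  using assms by (simp add: blaschke_factor_def norm_mult norm_divide)

text \<open>For \<open>norm a < 1\<close> the right side is nonnegative on the closed disk and
  vanishes on the unit circle, so this one identity gives modulus at most 1 inside and exactly 1 on
  the circle.\<close>

lemma norm_diff_sq_blaschke:
  "(norm (1 - cnj a * z))\<^sup>2 - (norm (a - z))\<^sup>2 = (1 - (norm a)\<^sup>2) * (1 - (norm z)\<^sup>2)"
  unfolding cmod_power2 by (simp add: algebra_simps power2_eq_square)

lemma norm_blaschke_factor_le_1:
  assumes "a \<noteq> 0" "norm a < 1" "norm z \<le> 1"
  shows "norm (blaschke_factor a z) \<le> 1"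
proof -
  have "0 \<le> (1 - (norm a)\<^sup>2) * (1 - (norm z)\<^sup>2)"
    using assms by (intro mult_nonneg_nonneg) (auto simp: power_le_one)
  then have "(norm (a - z))\<^sup>2 \<le> (norm (1 - cnj a * z))\<^sup>2"
    using norm_diff_sq_blaschke[of a z] by linarith
  then have "norm (a - z) \<le> norm (1 - cnj a * z)"
    by (rule power2_le_imp_le) simp
  then show ?thesis
    using blaschke_denominator_pos[OF assms(2,3)] assms(1) by (simp add: norm_blaschke_factor_eq)
qed

lemma norm_blaschke_factor_eq_1:
  assumes "a \<noteq> 0" "norm a < 1" "norm z = 1"
  shows "norm (blaschke_factor a z) = 1"
proof -
  have "(norm (a - z))\<^sup>2 = (norm (1 - cnj a * z))\<^sup>2"
    using norm_diff_sq_blaschke[of a z] assms(3) by simp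
  then have "norm (a - z) = norm (1 - cnj a * z)"
    by (rule power2_eq_imp_eq) simp_all
  moreover have "0 < norm (1 - cnj a * z)"
    using blaschke_denominator_pos assms by simp
  ultimately show ?thesis
    using assms(1) by (metis norm_blaschke_factor_eq divide_self less_irrefl)
qed

text \<open>Turns summability of \<open>1 - norm a\<close> over the zeros into absolute convergence
  of the product at each point. Up to sign, the numerator of \<open>blaschke_factor a z - 1\<close>
  is \<open>1 - norm a\<close> times a term of size at most \<open>2 * norm a\<close>, so the
  \<open>norm a\<close> in the denominator cancels.\<close>

lemma norm_blaschke_factor_minus_1_le:
  assumes "a \<noteq> 0" "norm a < 1" "norm z < 1"
  shows "norm (blaschke_factor a z - 1) \<le> (1 - norm a) * (2 / (1 - norm z))"
proof -
  have nz: "1 - cnj a * z \<noteq> 0" using blaschke_denominator_pos[of a z] assms by auto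
  have aa: "a * cnj a = of_real (norm a) * of_real (norm a)"
    by (simp add: complex_norm_square[symmetric] power2_eq_square[symmetric])
  have "blaschke_factor a z - 1 = - (of_real (1 - norm a) * (a + of_real (norm a) * z)) / (a * (1 - cnj a * z))"
    unfolding blaschke_factor_def using nz assms(1) aa by (simp add: field_simps) algebra
  then have "norm (blaschke_factor a z - 1) =
      \<bar>1 - norm a\<bar> * norm (a + of_real (norm a) * z) / (norm a * norm (1 - cnj a * z))"
    by (simp only: norm_divide norm_mult norm_minus_cancel norm_of_real)
  also have "\<dots> \<le> (1 - norm a) * (norm a * 2) / (norm a * (1 - norm z))"
  proof (rule frac_le)
    have "norm (a + of_real (norm a) * z) \<le> norm a + norm a * norm z"
      using norm_triangle_ineq[of a "of_real (norm a) * z"] by (simp add: norm_mult)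
    also have "\<dots> \<le> norm a * 2" using mult_left_mono[of "norm z" 1 "norm a"] assms by simp
    finally show "\<bar>1 - norm a\<bar> * norm (a + of_real (norm a) * z) \<le> (1 - norm a) * (norm a * 2)"
      using assms by (simp add: mult_left_mono)
    have "norm a * norm z \<le> norm z" using assms by (simp add: mult_left_le_one_le)
    then have "1 - norm z \<le> norm (1 - cnj a * z)"
      using norm_triangle_ineq2[of 1 "cnj a * z"] by (simp add: norm_mult)
    then show "norm a * (1 - norm z) \<le> norm a * norm (1 - cnj a * z)" by (simp add: mult_left_mono)
  qed (use assms in auto)
  also have "\<dots> = (1 - norm a) * (2 / (1 - norm z))" using assms(1) by simp
  finally show ?thesis .
qed

text \<open>Finite products stand in for \<open>B\<close> because they extend continuously to the
  closed disk with modulus 1 on the whole circle, whereas \<open>B\<close> is only known to have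
  radial limits almost everywhere.\<close>

lemma blaschke_partial_products:
  assumes "blaschke_product B"
  obtains P :: "nat \<Rightarrow> complex \<Rightarrow> complex"
  where "\<And>k. P k holomorphic_on ball 0 1" "\<And>k. continuous_on (cball 0 1) (P k)"
    "\<And>k z. norm z = 1 \<Longrightarrow> norm (P k z) = 1"
    "\<And>k z. norm z < 1 \<Longrightarrow> norm (P k z) \<le> 1"
    "\<And>k z. norm z < 1 \<Longrightarrow> norm (B z) \<le> norm (P k z)"
    "\<And>z. norm z < 1 \<Longrightarrow> (\<lambda>k. P k z) \<longlonglongrightarrow> B z"
proof -
  obtain c :: complex and m :: nat and N :: enat and \<alpha> :: "nat \<Rightarrow> complex" where
    c: "norm c = 1" and \<alpha>: "\<And>n. enat n < N \<Longrightarrow> \<alpha> n \<in> ball 0 1 - {0}"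
    and summ: "summable (\<lambda>n. if enat n < N then 1 - norm (\<alpha> n) else 0)"
    and B: "\<And>z. z \<in> ball 0 1 \<Longrightarrow>
      B z = c * z ^ m * prodinf (\<lambda>n. if enat n < N then blaschke_factor (\<alpha> n) z else 1)"
    using assms unfolding blaschke_product_def by blast
  define b where "b n z = (if enat n < N then blaschke_factor (\<alpha> n) z else 1)" for n z
  define P where "P k z = c * z ^ m * (\<Prod>n\<le>k. b n z)" for k z
  have \<alpha>': "\<alpha> n \<noteq> 0" "norm (\<alpha> n) < 1" if "enat n < N" for n
    using \<alpha>[OF that] by auto
  have nz: "1 - cnj (\<alpha> n) * z \<noteq> 0" if "enat n < N" "norm z \<le> 1" for n z
    using blaschke_denominator_pos[OF \<alpha>'(2)[OF that(1)] that(2)] by auto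
  have b1: "norm (b n z) = 1" if "norm z = 1" for n z
    using norm_blaschke_factor_eq_1[OF \<alpha>' that] by (auto simp: b_def)
  have ble: "norm (b n z) \<le> 1" if "norm z < 1" for n z
    using norm_blaschke_factor_le_1[OF \<alpha>', of n z] that by (auto simp: b_def)
  have hol: "b n holomorphic_on ball 0 1" for n
  proof (cases "enat n < N")
    case True
    show ?thesis unfolding b_def blaschke_factor_def using True \<alpha>'[OF True] nz[OF True]
      by (auto intro!: holomorphic_intros)
  next
    case False
    then have "b n = (\<lambda>z. 1)" by (simp add: b_def fun_eq_iff)
    then show ?thesis by simp
  qed
  have cont: "continuous_on (cball 0 1) (b n)" for n
  proof (cases "enat n < N")
    case True
    show ?thesis unfolding b_def blaschke_factor_def using True \<alpha>'[OF True] nz[OF True]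
      by (auto intro!: continuous_intros)
  next
    case False
    then have "b n = (\<lambda>z. 1)" by (simp add: b_def fun_eq_iff)
    then show ?thesis by simp
  qed
  have lim: "(\<lambda>k. P k z) \<longlonglongrightarrow> B z" if z: "norm z < 1" for z
  proof -
    have "summable (\<lambda>n. norm (b n z - 1))"
    proof (rule summable_comparison_test'[OF summable_mult2[OF summ, of "2 / (1 - norm z)"]])
      show "norm (norm (b n z - 1)) \<le> (if enat n < N then 1 - norm (\<alpha> n) else 0) * (2 / (1 - norm z))" for n
        using norm_blaschke_factor_minus_1_le[OF \<alpha>' z] by (simp add: b_def)
    qed
    then have "convergent_prod (\<lambda>n. b n z)"
      by (intro abs_convergent_prod_imp_convergent_prod summable_imp_abs_convergent_prod)
    then have "(\<lambda>k. P k z) \<longlonglongrightarrow> c * z ^ m * prodinf (\<lambda>n. b n z)"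
      unfolding P_def by (intro tendsto_mult_left convergent_prod_LIMSEQ)
    then show ?thesis using B[of z] z by (simp add: b_def)
  qed
  \<comment> \<open>The modulus decreases in \<open>k\<close> to its limit, so every partial product
    dominates \<open>B\<close>.\<close>
  have dec: "decseq (\<lambda>k. norm (P k z))" if z: "norm z < 1" for z
  proof (rule decseq_SucI)
    show "norm (P (Suc k) z) \<le> norm (P k z)" for k
      using mult_left_le[OF ble[OF z, of "Suc k"], of "norm (P k z)"] by (simp add: P_def norm_mult mult_ac)
  qed
  show thesis
  proof
    show "P k holomorphic_on ball 0 1" for k
      unfolding P_def using hol by (intro holomorphic_intros) auto
    show "continuous_on (cball 0 1) (P k)" for k
      unfolding P_def using cont by (intro continuous_intros) auto
    show "norm (P k z) = 1" if "norm z = 1" for k z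
      using that c b1 by (simp add: P_def norm_mult norm_power prod_norm[symmetric])
    show "norm (P k z) \<le> 1" if "norm z < 1" for k z
    proof -
      have "(\<Prod>n\<le>k. norm (b n z)) \<le> 1" using ble[OF that] by (intro prod_le_1) auto
      then have "norm z ^ m * (\<Prod>n\<le>k. norm (b n z)) \<le> 1"
        using that by (intro mult_le_one power_le_one prod_nonneg) auto
      then show ?thesis
        by (simp add: P_def norm_mult norm_power c prod_norm)
    qed
    show "norm (B z) \<le> norm (P k z)" if "norm z < 1" for k z
      using decseq_ge[OF dec[OF that] tendsto_norm[OF lim[OF that]]] .
    show "(\<lambda>k. P k z) \<longlonglongrightarrow> B z" if "norm z < 1" for z
      using lim[OF that] .
  qed
qed

text \<open>An inner function is only required to be bounded; the constant 1 comes from the partial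
  products.\<close>

lemma blaschke_product_le_1:
  assumes "blaschke_product B" "norm z < 1"
  shows "norm (B z) \<le> 1"
proof -
  obtain P :: "nat \<Rightarrow> complex \<Rightarrow> complex"
    where "\<And>k z. norm z < 1 \<Longrightarrow> norm (P k z) \<le> 1"
      "\<And>k z. norm z < 1 \<Longrightarrow> norm (B z) \<le> norm (P k z)"
    using blaschke_partial_products[OF assms(1)] by metis
  then show ?thesis using assms(2) order_trans by blast
qed

lemma blaschke_product_holomorphic: "blaschke_product B \<Longrightarrow> B holomorphic_on ball 0 1"
  by (simp add: blaschke_product_def inner_function_def)

section \<open>Comparison by the maximum principle\<close>

text \<open>The maximum principle has to be applied on a disk of radius \<open>r < 1\<close>, since
  \<open>B'\<close> need not extend to the unit circle. Uniform continuity keeps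
  \<open>norm (g z)\<close> above \<open>s\<close> on a circle close to it, and \<open>r0\<close>
  lets that circle surround a prescribed point.\<close>

lemma near_circle:
  fixes g :: "complex \<Rightarrow> complex"
  assumes cont: "continuous_on (cball 0 1) g" and one: "\<And>z. norm z = 1 \<Longrightarrow> norm (g z) = 1"
    and s: "s < 1" and r0: "r0 < 1"
  obtains r where "r0 < r" "0 < r" "r < 1" "\<And>z. norm z = r \<Longrightarrow> s < norm (g z)"
proof -
  have "uniformly_continuous_on (cball 0 1) g"
    using cont by (simp add: compact_uniformly_continuous)
  then obtain d where d: "d > 0"
    "\<And>x y. \<lbrakk>x \<in> cball 0 1; y \<in> cball 0 1; dist y x < d\<rbrakk> \<Longrightarrow> dist (g y) (g x) < 1 - s"
    using s unfolding uniformly_continuous_on_def by (metis diff_gt_0_iff_gt)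
  \<comment> \<open>The three entries secure \<open>r0 < r\<close>, \<open>0 < r\<close> and
    \<open>1 - r < d\<close>, in this order.\<close>
  define r where "r = Max {(1 + r0) / 2, 1 / 2, 1 - d / 2}"
  have r: "r0 < r" "0 < r" "r < 1" "1 - r < d"
    using d(1) r0 by (auto simp: r_def less_max_iff_disj)
  show thesis
  proof
    fix z :: complex assume z: "norm z = r"
    define w where "w = z / of_real r"
    have w: "norm w = 1" using z r by (simp add: w_def norm_divide)
    have "w - z = of_real (1 - r) * w" using r by (simp add: w_def field_simps)
    then have "dist w z = 1 - r" using w r by (simp only: dist_norm norm_mult norm_of_real) simp
    then have "dist (g w) (g z) < 1 - s" using d(2)[of z w] w z r by simp
    then show "s < norm (g z)"
      using norm_triangle_ineq2[of "g w" "g z"] one[OF w] by (simp add: dist_norm)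
  qed (use r in auto)
qed

text \<open>The factor \<open>1 + 1/q\<close> is rational so that the holomorphic quotient
  \<open>B' ^ Suc q / P k ^ q\<close> and the maximum modulus principle can replace logarithms and
  harmonic functions. Where \<open>norm (B' z) = a\<close>, the condition on \<open>a\<close>,
  \<open>\<eta>\<close> and \<open>q\<close> bounds the quotient by 1; near the unit circle
  \<open>norm (B' z) \<le> 1\<close> and \<open>P k\<close> is almost unimodular.\<close>

lemma blaschke_comparison:
  fixes a :: real
  assumes B: "blaschke_product B" and B': "blaschke_product B'"
    and a: "0 < a" and \<eta>: "\<eta> < a" "a ^ Suc q \<le> (a - \<eta>) ^ q"
    and close: "\<And>z. norm z < 1 \<Longrightarrow> norm (B' z - B z) \<le> \<eta>"
    and z0: "norm z0 < 1" "a < norm (B' z0)"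
  shows "norm (B' z0) ^ Suc q \<le> norm (B z0) ^ q"
proof -
  obtain P :: "nat \<Rightarrow> complex \<Rightarrow> complex" where
    hol: "\<And>k. P k holomorphic_on ball 0 1" and cont: "\<And>k. continuous_on (cball 0 1) (P k)"
    and P1: "\<And>k z. norm z = 1 \<Longrightarrow> norm (P k z) = 1"
    and BP: "\<And>k z. norm z < 1 \<Longrightarrow> norm (B z) \<le> norm (P k z)"
    and lim: "\<And>z. norm z < 1 \<Longrightarrow> (\<lambda>k. P k z) \<longlonglongrightarrow> B z"
    using blaschke_partial_products[OF B] by metis
  note hol' = blaschke_product_holomorphic[OF B'] and le1 = blaschke_product_le_1[OF B']
  \<comment> \<open>As \<open>P k\<close> dominates \<open>B\<close>, the lower bound for
    \<open>B\<close> passes to all partial products; they have no zeros where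
    \<open>a \<le> norm (B' z)\<close>, and the quotient has no poles there.\<close>
  have lower: "a - \<eta> \<le> norm (P k z)" if "norm z < 1" "a \<le> norm (B' z)" for k z
    using norm_triangle_ineq2[of "B' z" "B z"] close[OF that(1)] that(2) BP[OF that(1), of k] by linarith
  \<comment> \<open>The factor \<open>s < 1\<close> is the price of stopping at a circle of radius
    \<open>r < 1\<close>, on which \<open>norm (P k z) ^ q\<close> is only known to exceed
    \<open>s\<close>.\<close>
  have step: "norm (B' z0) ^ Suc q * s \<le> norm (P k z0) ^ q" if s: "0 < s" "s < 1" for k s
  proof -
    have "continuous_on (cball 0 1) (\<lambda>z. P k z ^ q)"
      by (intro continuous_intros cont)
    then obtain r where r: "norm z0 < r" "0 < r" "r < 1" and rs: "\<And>z. norm z = r \<Longrightarrow> s < norm (P k z ^ q)"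
      using near_circle[of "\<lambda>z. P k z ^ q" s "norm z0"] P1 s z0(1) by (auto simp: norm_power)
    \<comment> \<open>The frontier of \<open>U\<close> is never computed: it lies in the closed set
      \<open>K\<close> and misses the open set \<open>U\<close>, and such points have
      \<open>norm z = r\<close> or \<open>norm (B' z) = a\<close>.\<close>
    define U where "U = {z \<in> ball 0 r. a < norm (B' z)}"
    define K where "K = {z \<in> cball 0 r. a \<le> norm (B' z)}"
    define f where "f z = B' z ^ Suc q / P k z ^ q" for z
    have sub: "cball 0 r \<subseteq> (ball 0 1 :: complex set)" using r by auto
    have contB': "continuous_on (cball 0 r) B'"
      using hol' sub holomorphic_on_imp_continuous_on continuous_on_subset by blast
    have K: "closed K" unfolding K_def
      by (intro continuous_on_closed_Collect_le continuous_intros contB' closed_cball)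
    have U: "open U"
    proof -
      have "open (ball 0 r \<inter> (\<lambda>z. norm (B' z)) -` {a<..})"
        by (intro continuous_open_preimage continuous_intros continuous_on_subset[OF contB']) auto
      moreover have "U = ball 0 r \<inter> (\<lambda>z. norm (B' z)) -` {a<..}" by (auto simp: U_def)
      ultimately show ?thesis by simp
    qed
    have clU: "closure U \<subseteq> K" by (rule closure_minimal[OF _ K]) (auto simp: U_def K_def)
    have K1: "K \<subseteq> ball 0 1" using sub by (auto simp: K_def)
    have nz: "P k z \<noteq> 0" if "z \<in> K" for z
      using lower[of z k] that K1 \<eta>(1) by (auto simp: K_def)
    have holf: "f holomorphic_on S" if "S \<subseteq> ball 0 1" "\<And>z. z \<in> S \<Longrightarrow> P k z \<noteq> 0" for S
      unfolding f_def using that hol[of k] hol'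
      by (intro holomorphic_intros) (auto intro: holomorphic_on_subset)
    have Kf: "f holomorphic_on K" using holf[OF K1 nz] .
    have "norm (f z0) \<le> 1 / s"
    proof (rule maximum_modulus_frontier[of f U])
      show "f holomorphic_on interior U"
        using Kf clU closure_subset interior_subset holomorphic_on_subset by (metis order_trans)
      show "continuous_on (closure U) f"
        using Kf clU holomorphic_on_imp_continuous_on continuous_on_subset by blast
      show "bounded U" by (rule bounded_subset[OF bounded_ball[of 0 r]]) (auto simp: U_def)
      show "z0 \<in> U" using r z0 by (simp add: U_def)
      fix z assume "z \<in> frontier U"
      then have zK: "z \<in> K" and zU: "z \<notin> U" using clU U by (auto simp: frontier_def interior_open)
      have z1: "norm z < 1" using zK K1 by auto
      have Pz: "0 < norm (P k z) ^ q" using nz[OF zK] by simp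
      show "norm (f z) \<le> 1 / s"
      proof (cases "norm z = r")
        case True
        have "norm (B' z) ^ Suc q \<le> 1" using le1[OF z1] by (intro power_le_one) auto
        then have "norm (B' z) ^ Suc q / norm (P k z) ^ q \<le> 1 / s"
          using rs[OF True] s by (intro frac_le) (auto simp: norm_power)
        then show ?thesis by (simp only: f_def norm_divide norm_power)
      next
        case False
        then have "norm (B' z) = a" using zK zU by (auto simp: K_def U_def)
        then have "norm (B' z) ^ Suc q \<le> norm (P k z) ^ q"
          using \<eta> power_mono[OF lower[OF z1, of k], of q] by simp
        then have "norm (B' z) ^ Suc q / norm (P k z) ^ q \<le> 1"
          using Pz by (simp only: divide_le_eq_1) simp
        also have "1 \<le> 1 / s" using s by simp
        finally show ?thesis by (simp only: f_def norm_divide norm_power)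
      qed
    qed
    then have le: "norm (B' z0) ^ Suc q / norm (P k z0) ^ q \<le> 1 / s"
      by (simp only: f_def norm_divide norm_power)
    have "0 < norm (P k z0) ^ q" using nz[of z0] r z0 by (simp add: K_def)
    with le s show ?thesis by (simp add: field_simps)
  qed
  \<comment> \<open>The radius is gone from the bound, so \<open>s\<close> may tend to 1 for each
    fixed \<open>k\<close>; afterwards \<open>k\<close> tends to infinity.\<close>
  have "norm (B' z0) ^ Suc q \<le> norm (P k z0) ^ q" for k
  proof (rule field_le_mult_one_interval)
    fix s :: real assume "0 < s" "s < 1"
    then show "s * norm (B' z0) ^ Suc q \<le> norm (P k z0) ^ q"
      using step[of s k] by (simp add: mult.commute)
  qed
  moreover have "(\<lambda>k. norm (P k z0) ^ q) \<longlonglongrightarrow> norm (B z0) ^ q"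
    by (intro tendsto_intros lim z0)
  ultimately show ?thesis
    by (intro LIMSEQ_le_const[of _ "norm (B z0) ^ q"]) auto
qed

section \<open>Inclusions of sublevel sets\<close>

lemma level_pos: "0 < t \<Longrightarrow> 0 < level t"
  by (simp add: level_def add_pos_pos)

lemma level_less_1: "level t < 1"
  by (simp add: level_def divide_less_eq add_pos_pos)

lemma level_strict_mono:
  assumes "s < t"
  shows "level s < level t"
proof -
  have "level x = 1 - 2 / (exp x + 1)" for x
  proof -
    have "exp x + 1 \<noteq> 0" using exp_gt_zero[of x] by linarith
    then show ?thesis by (simp add: level_def field_simps)
  qed
  moreover have "2 / (exp t + 1) < 2 / (exp s + 1)"
    using assms by (intro divide_strict_left_mono) (auto simp: add_pos_pos)
  ultimately show ?thesis by simp
qed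

text \<open>Convexity of \<open>artanh\<close> on \<open>[0,1)\<close> together with
  \<open>artanh 0 = 0\<close>; in terms of derivatives, \<open>1 / (1 - s\<^sup>2)\<close> increases
  with \<open>s\<close>.\<close>

lemma artanh_mult_le:
  fixes c x :: real
  assumes "0 \<le> c" "c \<le> 1" "0 \<le> x" "x < 1"
  shows "artanh (c * x) \<le> c * artanh x"
proof -
  have "c * artanh 0 - artanh (c * 0) \<le> c * artanh x - artanh (c * x)"
  proof (rule DERIV_nonneg_imp_nondecreasing[of 0 x "\<lambda>s. c * artanh s - artanh (c * s)"])
    fix s assume s: "0 \<le> s" "s \<le> x"
    have cs: "0 \<le> c * s" "c * s \<le> s" using s assms by (auto simp: mult_left_le_one_le)
    have d: "((\<lambda>s. c * artanh s - artanh (c * s)) has_real_derivative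
        c * (1 / (1 - s\<^sup>2)) - 1 / (1 - (c * s)\<^sup>2) * c) (at s)"
      using s cs assms
      by (auto intro!: derivative_eq_intros DERIV_chain2[of artanh])
    have "s\<^sup>2 < 1" using s assms by (simp add: power_less_one_iff abs_square_less_1)
    moreover have "(c * s)\<^sup>2 \<le> s\<^sup>2" using cs by (intro power_mono)
    ultimately have le: "1 / (1 - (c * s)\<^sup>2) \<le> 1 / (1 - s\<^sup>2)" by (intro divide_left_mono) auto
    have "0 \<le> c * (1 / (1 - s\<^sup>2)) - 1 / (1 - (c * s)\<^sup>2) * c"
      using mult_left_mono[OF le assms(1)] by (simp add: mult.commute)
    with d show "\<exists>y. ((\<lambda>s. c * artanh s - artanh (c * s)) has_real_derivative y) (at s) \<and> 0 \<le> y"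
      by blast
  qed (use assms in auto)
  then show ?thesis by simp
qed

text \<open>Here \<open>level t\<close> is \<open>tanh (t / 2)\<close>. In this form a shift of
  \<open>t\<close> by \<open>\<Delta>\<close> multiplies the argument of \<open>artanh\<close> by
  \<open>exp (- \<Delta>)\<close>.\<close>

lemma ln_level:
  assumes "0 < t"
  shows "ln (level t) = - (2 * artanh (exp (- t)))"
proof -
  have lt: "exp (- t) < 1" using assms by simp
  have "level t = (1 - exp (- t)) / (1 + exp (- t))"
  proof -
    have "exp t + 1 \<noteq> 0" "1 + exp (- t) \<noteq> 0"
      using exp_gt_zero[of t] exp_gt_zero[of "- t"] by linarith+
    moreover have "exp t * exp (- t) = 1" by (simp add: exp_minus)
    ultimately show ?thesis by (simp add: level_def frac_eq_eq algebra_simps)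
  qed
  then show ?thesis using lt by (simp add: artanh_def ln_div add_pos_pos)
qed

text \<open>By \<open>artanh_mult_le\<close>, \<open>- ln (level t)\<close> shrinks at least by the
  factor \<open>exp (- \<Delta>)\<close> over a time \<open>\<Delta>\<close>, and
  \<open>exp \<Delta> \<ge> 1 + \<Delta> \<ge> (q + 1) / q\<close>.\<close>

lemma level_power_le:
  assumes "0 < t" "0 < \<Delta>" "1 \<le> \<Delta> * real q"
  shows "level t ^ q \<le> level (t + \<Delta>) ^ Suc q"
proof -
  define x where "x = artanh (exp (- t))"
  have x: "0 \<le> x"
    using assms(1) level_less_1[of t] ln_level[of t] level_pos[of t]
      ln_less_zero[of "level t"]
    by (simp add: x_def)
  have "artanh (exp (- (t + \<Delta>))) = artanh (exp (- \<Delta>) * exp (- t))"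
    by (simp add: exp_add[symmetric] add.commute)
  also have "\<dots> \<le> exp (- \<Delta>) * x"
    unfolding x_def using assms by (intro artanh_mult_le) auto
  finally have "real (Suc q) * artanh (exp (- (t + \<Delta>))) \<le> real (Suc q) * (exp (- \<Delta>) * x)"
    by (intro mult_left_mono) auto
  also have "\<dots> \<le> real q * x"
  proof -
    have "real (Suc q) \<le> real q * (1 + \<Delta>)" using assms by (simp add: algebra_simps)
    also have "\<dots> \<le> real q * exp \<Delta>" by (intro mult_left_mono exp_ge_add_one_self) auto
    finally have "real (Suc q) * exp (- \<Delta>) \<le> real q" by (simp add: exp_minus field_simps)
    then show ?thesis using mult_right_mono[OF _ x] by (metis mult.assoc)
  qed
  finally have "real q * ln (level t) \<le> real (Suc q) * ln (level (t + \<Delta>))"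
    using ln_level[of t] ln_level[of "t + \<Delta>"] assms by (simp add: x_def)
  then have "ln (level t ^ q) \<le> ln (level (t + \<Delta>) ^ Suc q)"
    using assms level_pos[of t] level_pos[of "t + \<Delta>"] by (simp only: ln_realpow)
  then show ?thesis
    using assms level_pos[of t] level_pos[of "t + \<Delta>"] by (subst (asm) ln_le_cancel_iff) auto
qed

text \<open>A point with \<open>level (t + \<Delta>) \<le> norm (B' z)\<close> lies above the
  threshold \<open>level \<Delta>\<close>, whatever \<open>t > 0\<close> is, so the comparison
  applies to it; the growth of \<open>level\<close> then contradicts
  \<open>norm (B z) < level t\<close>.\<close>

lemma sublevel_inclusion:
  assumes B: "blaschke_product B" and B': "blaschke_product B'"
    and \<Delta>: "0 < \<Delta>" "1 \<le> \<Delta> * real q"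
    and \<eta>: "\<eta> < level \<Delta>" "level \<Delta> ^ Suc q \<le> (level \<Delta> - \<eta>) ^ q"
    and close: "\<And>z. norm z < 1 \<Longrightarrow> norm (B' z - B z) \<le> \<eta>"
    and t: "0 < t"
  shows "sublevel B (level t) \<subseteq> sublevel B' (level (t + \<Delta>))"
proof
  fix z assume "z \<in> sublevel B (level t)"
  then have z: "norm z < 1" and Bz: "norm (B z) < level t" by (auto simp: sublevel_def)
  have "norm (B' z) < level (t + \<Delta>)"
  proof (rule ccontr)
    assume "\<not> ?thesis"
    then have ge: "level (t + \<Delta>) \<le> norm (B' z)" by simp
    have "level \<Delta> < level (t + \<Delta>)"
      using level_strict_mono t by simp
    then have "norm (B' z) ^ Suc q \<le> norm (B z) ^ q"
      using ge by (intro blaschke_comparison[OF B B' level_pos[OF \<Delta>(1)] \<eta> close z]) auto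
    \<comment> \<open>Strictness needs a positive \<open>q\<close>, which
      \<open>1 \<le> \<Delta> * real q\<close> ensures.\<close>
    also have "\<dots> < level t ^ q"
      using Bz \<Delta> by (intro power_strict_mono) (auto intro!: Nat.gr0I)
    also have "\<dots> \<le> level (t + \<Delta>) ^ Suc q" by (rule level_power_le[OF t \<Delta>])
    also have "\<dots> \<le> norm (B' z) ^ Suc q"
      using ge level_pos[of "t + \<Delta>"] t \<Delta> by (intro power_mono) auto
    finally show False by simp
  qed
  with z show "z \<in> sublevel B' (level (t + \<Delta>))" by (simp add: sublevel_def)
qed

section \<open>Interleavings induced by inclusions\<close>

text \<open>Only the target function occurs, because a class is mapped to its coset modulo the
  boundaries of the larger space. So one formula serves the structure maps and the maps between two
  modules; for \<open>s \<le> 0\<close> the source is the zero space.\<close>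

definition inclusion_map ::
  "('k,'m) ring_scheme \<Rightarrow> (complex \<Rightarrow> complex) \<Rightarrow> real \<Rightarrow> real \<Rightarrow>
   ('k,complex) coeff_chain set \<Rightarrow> ('k,complex) coeff_chain set" where
  "inclusion_map F v s t =
     (if 0 < s then homology_inclusion F 0 (top_of_set (sublevel v (level t)))
      else (\<lambda>_. \<zero>\<^bsub>inner_space F v t\<^esub>))"

lemma pmap_inner_persistence: "pmap (inner_persistence F u) s t = inclusion_map F u s t"
  by (simp add: inner_persistence_def inclusion_map_def)

lemma pspace_inner_persistence: "pspace (inner_persistence F u) t = inner_space F u t"
  by (simp add: inner_persistence_def)

lemma inclusion_map_linear:
  assumes "field F" "s \<le> t" "0 < s \<Longrightarrow> sublevel u (level s) \<subseteq> sublevel v (level t)"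
  shows "inclusion_map F v s t \<in> linear_maps F (inner_space F u s) (inner_space F v t)"
proof (cases "0 < s")
  case True
  then show ?thesis
    using homology_inclusion_linear[OF assms(1) assms(3)[OF True]] assms(2)
    by (simp add: inclusion_map_def inner_space_def)
next
  case False
  then show ?thesis
    using zero_map_linear[OF inner_space_module[OF assms(1)]] by (simp add: inclusion_map_def)
qed

lemma linear_maps_zero:
  assumes "module F M" "module F N" "h \<in> linear_maps F M N"
  shows "h \<zero>\<^bsub>M\<^esub> = \<zero>\<^bsub>N\<^esub>"
proof -
  interpret M: module F M by fact
  interpret N: module F N by fact
  have "h \<zero>\<^bsub>M\<^esub> \<in> carrier N" "h (\<zero>\<^bsub>F\<^esub> \<odot>\<^bsub>M\<^esub> \<zero>\<^bsub>M\<^esub>) = \<zero>\<^bsub>F\<^esub> \<odot>\<^bsub>N\<^esub> h \<zero>\<^bsub>M\<^esub>"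
    using assms(3) M.zero_closed M.R.zero_closed unfolding linear_maps_def hom_def by fastforce+
  then show ?thesis by simp
qed

text \<open>With three functions allowed to differ, this covers naturality and both composites of an
  interleaving. For \<open>0 < s\<close> both sides send the class of a chain \<open>c\<close> to
  the class of the same \<open>c\<close>; for \<open>s \<le> 0\<close> both are zero.\<close>

lemma inclusion_map_comp:
  assumes F: "field F" and st: "s \<le> t" and tr: "t \<le> r"
    and uv: "0 < s \<Longrightarrow> sublevel u (level s) \<subseteq> sublevel v (level t)"
    and vw: "0 < t \<Longrightarrow> sublevel v (level t) \<subseteq> sublevel w (level r)"
    and x: "x \<in> carrier (inner_space F u s)"
  shows "inclusion_map F w t r (inclusion_map F v s t x) = inclusion_map F w s r x"
proof (cases "0 < s")
  case True
  then have t: "0 < t" using st by simp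
  obtain c where c: "c \<in> carrier (chain_space F 0 (top_of_set (sublevel u (level s))))"
    "x = boundaries F 0 (top_of_set (sublevel u (level s)))
      +>\<^bsub>chain_space F 0 (top_of_set (sublevel u (level s)))\<^esub> c"
    using x True by (auto simp: inner_space_def homology_0_carrier)
  have c': "c \<in> carrier (chain_space F 0 (top_of_set (sublevel v (level t))))"
    using chain_space_mono[OF uv[OF True]] c(1) by blast
  note incl = homology_inclusion_coset[OF F, where Y = euclidean]
  show ?thesis
    using True t
    by (simp add: inclusion_map_def c(2) incl[OF uv[OF True] c(1)] incl[OF vw[OF t] c']
        incl[OF order_trans[OF uv[OF True] vw[OF t]] c(1)])
next
  case False
  have "inclusion_map F w t r \<zero>\<^bsub>inner_space F v t\<^esub> = \<zero>\<^bsub>inner_space F w r\<^esub>"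
    by (rule linear_maps_zero[OF inner_space_module[OF F] inner_space_module[OF F]
          inclusion_map_linear[OF F tr vw]])
  then show ?thesis using False by (simp add: inclusion_map_def)
qed

lemma inclusion_map_hom:
  assumes F: "field F" and \<Delta>: "0 < \<Delta>"
    and uv: "\<And>t. 0 < t \<Longrightarrow> sublevel u (level t) \<subseteq> sublevel v (level (t + \<Delta>))"
  shows "persistence_hom F (inner_persistence F u) (pshift \<Delta> (inner_persistence F v))
    (\<lambda>t. inclusion_map F v t (t + \<Delta>))"
  unfolding persistence_hom_def
proof (intro conjI allI impI ballI)
  show "inclusion_map F v t (t + \<Delta>) \<in> linear_maps F (pspace (inner_persistence F u) t)
      (pspace (pshift \<Delta> (inner_persistence F v)) t)" for t
    using inclusion_map_linear[OF F _ uv, of t] \<Delta>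
    by (simp add: pshift_def pspace_inner_persistence)
  fix s t :: real and x
  assume st: "s \<le> t" and x: "x \<in> carrier (pspace (inner_persistence F u) s)"
  then have x: "x \<in> carrier (inner_space F u s)" by (simp add: pspace_inner_persistence)
  \<comment> \<open>Both ways round the naturality square equal the direct map from \<open>u\<close>
    at time \<open>s\<close> to \<open>v\<close> at time \<open>t + \<Delta>\<close>.\<close>
  have "inclusion_map F v t (t + \<Delta>) (inclusion_map F u s t x) = inclusion_map F v s (t + \<Delta>) x"
    using st \<Delta> uv sublevel_mono[of s t u] by (intro inclusion_map_comp[OF F _ _ _ _ x]) auto
  also have "\<dots> = inclusion_map F v (s + \<Delta>) (t + \<Delta>) (inclusion_map F v s (s + \<Delta>) x)"
    using st \<Delta> uv sublevel_mono[of "s + \<Delta>" "t + \<Delta>" v]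
    by (intro inclusion_map_comp[OF F _ _ _ _ x, symmetric]) auto
  finally show "inclusion_map F v t (t + \<Delta>) (pmap (inner_persistence F u) s t x) =
      pmap (pshift \<Delta> (inner_persistence F v)) s t (inclusion_map F v s (s + \<Delta>) x)"
    by (simp add: pshift_def pmap_inner_persistence)
qed

lemma inclusion_map_roundtrip:
  assumes F: "field F" and \<Delta>: "0 < \<Delta>"
    and uv: "\<And>t. 0 < t \<Longrightarrow> sublevel u (level t) \<subseteq> sublevel v (level (t + \<Delta>))"
    and vu: "\<And>t. 0 < t \<Longrightarrow> sublevel v (level t) \<subseteq> sublevel u (level (t + \<Delta>))"
    and x: "x \<in> carrier (inner_space F u t)"
  shows "hom_shift \<Delta> (\<lambda>t. inclusion_map F u t (t + \<Delta>)) t (inclusion_map F v t (t + \<Delta>) x) =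
    shift_hom (2 * \<Delta>) (inner_persistence F u) t x"
proof -
  have "inclusion_map F u (t + \<Delta>) (t + \<Delta> + \<Delta>) (inclusion_map F v t (t + \<Delta>) x) =
      inclusion_map F u t (t + \<Delta> + \<Delta>) x"
    using \<Delta> by (intro inclusion_map_comp[OF F _ _ uv vu x]) auto
  moreover have "t + \<Delta> + \<Delta> = t + 2 * \<Delta>" by simp
  ultimately show ?thesis
    by (simp only: hom_shift_def shift_hom_def pmap_inner_persistence)
qed

lemma interleaved_if_sublevels_included:
  assumes F: "field F" and \<Delta>: "0 < \<Delta>"
    and uv: "\<And>t. 0 < t \<Longrightarrow> sublevel u (level t) \<subseteq> sublevel v (level (t + \<Delta>))"
    and vu: "\<And>t. 0 < t \<Longrightarrow> sublevel v (level t) \<subseteq> sublevel u (level (t + \<Delta>))"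
  shows "interleaved F \<Delta> (inner_persistence F u) (inner_persistence F v)"
  unfolding interleaved_def
proof (rule exI[of _ "\<lambda>t. inclusion_map F v t (t + \<Delta>)"],
    rule exI[of _ "\<lambda>t. inclusion_map F u t (t + \<Delta>)"], intro conjI allI ballI)
qed (use inclusion_map_hom[OF F \<Delta> uv] inclusion_map_hom[OF F \<Delta> vu]
    inclusion_map_roundtrip[OF F \<Delta> uv vu] inclusion_map_roundtrip[OF F \<Delta> vu uv] in
    \<open>simp_all only: pspace_inner_persistence\<close>)

section \<open>From the supremum norm to the interleaving distance\<close>

lemma norm_le_disk_sup_norm:
  assumes "\<And>z. norm z < 1 \<Longrightarrow> norm (f z) \<le> M" "norm z < 1"
  shows "norm (f z) \<le> disk_sup_norm f"
  unfolding disk_sup_norm_def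
  using assms by (intro cSUP_upper bdd_aboveI2[where M = M]) auto

theorem theoremB:
  fixes F :: "('k,'m) ring_scheme" and B :: "complex \<Rightarrow> complex"
  assumes "field F"
    and "blaschke_product B"
    and "strong_property_B B"
  shows "\<forall>\<epsilon>::real. 0 < \<epsilon> \<longrightarrow>
           (\<exists>\<eta>::real. 0 < \<eta> \<and> \<eta> < 1 \<and>
              (\<forall>B'::complex \<Rightarrow> complex.
                 blaschke_product B' \<and> strong_property_B B' \<and>
                 disk_sup_norm (\<lambda>z. B' z - B z) < \<eta> \<longrightarrow>
                 interleaving_dist F (inner_persistence F B) (inner_persistence F B') < ereal \<epsilon>))"
proof (intro allI impI)
  fix \<epsilon> :: real assume \<epsilon>: "0 < \<epsilon>"
  \<comment> \<open>The distance is an infimum, so a \<open>\<Delta>\<close>-interleaving bounds it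
    by \<open>\<epsilon> / 2\<close>, strictly below \<open>\<epsilon>\<close>.\<close>
  define \<Delta> where "\<Delta> = \<epsilon> / 2"
  have \<Delta>: "0 < \<Delta>" using \<epsilon> by (simp add: \<Delta>_def)
  define a where "a = level \<Delta>"
  have a: "0 < a" "a < 1" using level_pos[OF \<Delta>] level_less_1 by (auto simp: a_def)
  obtain q :: nat where "1 / \<Delta> \<le> real q" using real_arch_simple by blast
  then have q: "1 \<le> \<Delta> * real q" using \<Delta> by (simp add: field_simps)
  then have q0: "0 < q" by (auto intro!: Nat.gr0I)
  \<comment> \<open>Chosen so that \<open>(a - \<eta>) ^ q\<close> equals \<open>a ^ Suc q\<close>,
    the extreme case allowed in the comparison. Since \<open>a\<close> and \<open>q\<close> are
    fixed before \<open>B'\<close>, one \<open>\<eta>\<close> serves every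
    \<open>B'\<close>.\<close>
  define \<eta> where "\<eta> = a - a * root q a"
  have rt: "0 < root q a" "root q a < 1" using a q0 by auto
  have \<eta>: "0 < \<eta>" "\<eta> < a"
    using a rt mult_strict_left_mono[of "root q a" 1 a] by (auto simp: \<eta>_def)
  then have \<eta>1: "\<eta> < 1" using a by simp
  have pow: "a ^ Suc q \<le> (a - \<eta>) ^ q"
    using a q0 by (simp add: \<eta>_def power_mult_distrib real_root_pow_pos2)
  show "\<exists>\<eta>::real. 0 < \<eta> \<and> \<eta> < 1 \<and>
      (\<forall>B'::complex \<Rightarrow> complex.
         blaschke_product B' \<and> strong_property_B B' \<and>
         disk_sup_norm (\<lambda>z. B' z - B z) < \<eta> \<longrightarrow>
         interleaving_dist F (inner_persistence F B) (inner_persistence F B') < ereal \<epsilon>)"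
  proof (intro exI[of _ \<eta>] conjI allI impI \<eta> \<eta>1)
    fix B' :: "complex \<Rightarrow> complex"
    assume "blaschke_product B' \<and> strong_property_B B' \<and> disk_sup_norm (\<lambda>z. B' z - B z) < \<eta>"
    then have B': "blaschke_product B'" and sup: "disk_sup_norm (\<lambda>z. B' z - B z) < \<eta>" by auto
    have close: "norm (B' z - B z) \<le> \<eta>" if "norm z < 1" for z
    proof -
      \<comment> \<open>The crude bound 2 makes the set bounded above, so that its real supremum
        dominates each value.\<close>
      have "norm (B' w - B w) \<le> 2" if "norm w < 1" for w
        using norm_triangle_ineq4[of "B' w" "B w"] blaschke_product_le_1[OF B' that]
          blaschke_product_le_1[OF assms(2) that] by linarith
      from norm_le_disk_sup_norm[of "\<lambda>z. B' z - B z", OF this that] sup show ?thesis by simp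
    qed
    have close': "norm (B z - B' z) \<le> \<eta>" if "norm z < 1" for z
      using close[OF that] by (simp add: norm_minus_commute)
    \<comment> \<open>The conditions linking \<open>\<Delta>\<close>, \<open>q\<close> and
      \<open>\<eta>\<close> mention neither function, so exchanging \<open>B\<close> and
      \<open>B'\<close> gives the second inclusion.\<close>
    have "interleaved F \<Delta> (inner_persistence F B) (inner_persistence F B')"
      using sublevel_inclusion[OF assms(2) B' \<Delta> q _ _ close] sublevel_inclusion[OF B' assms(2) \<Delta> q _ _ close']
        \<eta>(2) pow
      by (intro interleaved_if_sublevels_included[OF assms(1) \<Delta>]) (auto simp: a_def)
    then have "interleaving_dist F (inner_persistence F B) (inner_persistence F B') \<le> ereal \<Delta>"
      unfolding interleaving_dist_def using \<Delta> by (intro INF_lower) auto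
    also have "\<dots> < ereal \<epsilon>" using \<epsilon> by (simp add: \<Delta>_def)
    finally show "interleaving_dist F (inner_persistence F B) (inner_persistence F B') < ereal \<epsilon>" .
  qed
qed

end
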